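(* Let $\mathscr{H}$ be a complex Hilbert space and let $A$ be a bounded linear operator on $\mathscr{H}$. Then $$\frac{1}{2}\|\Re(A^2)\|+\frac{1}{2}w(A)\,\big| \|\Re(A)\|-\|\Im(A)\|\big| \;\leq\; w^2(A) \;\leq\; \frac{1}{2}\,w(|A|+i|A^*|)\,w(|A^*|+i|A|).$$
   Context: For a bounded linear operator $A$ on a complex Hilbert space $\mathscr{H}$ with inner product $\langle\cdot,\cdot\rangle$: $A^*$ is the adjoint, $\|A\|$ is the operator norm, $|A|=(A^*A)^{1/2}$ is the positive square root, $\Re(A)=\frac12(A+A^* )$ and $\Im(A)=\frac{1}{2i}(A-A^* )$. The numerical radius is $w(A)=\sup\{|\langle Ax,x\rangle| : x\in\mathscr{H}, \|x\|=1\}$, and $w^2(A)$ denotes $(w(A))^2$. *)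

theory Defs
  imports "HOL-Analysis.Analysis"
begin

text \<open>
  A complex Hilbert space. The real structure underlying it (norm, topology, real scalar
  multiplication, real inner product) is the library's, tied to the complex structure by the
  axioms \<open>scaleR_scaleC\<close> and \<open>inner_eq_Re_cinner\<close>; in particular
  \<open>norm x = sqrt (Re (cinner x x))\<close>. Inner products are linear in the first argument.
\<close>

class complex_hilbert = real_inner + complete_space +
  fixes scaleC :: "complex \<Rightarrow> 'a \<Rightarrow> 'a"  (infixr "*\<^sub>C" 75)
    and cinner :: "'a \<Rightarrow> 'a \<Rightarrow> complex"
  assumes scaleC_add_right: "c *\<^sub>C (x + y) = c *\<^sub>C x + c *\<^sub>C y"
    and scaleC_add_left: "(c + d) *\<^sub>C x = c *\<^sub>C x + d *\<^sub>C x"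
    and scaleC_scaleC: "c *\<^sub>C d *\<^sub>C x = (c * d) *\<^sub>C x"
    and scaleR_scaleC: "r *\<^sub>R x = complex_of_real r *\<^sub>C x"
    and cinner_add_left: "cinner (x + y) z = cinner x z + cinner y z"
    and cinner_scaleC_left: "cinner (c *\<^sub>C x) y = c * cinner x y"
    and cinner_commute: "cinner x y = cnj (cinner y x)"
    and inner_eq_Re_cinner: "inner x y = Re (cinner x y)"

definition bounded_clinear :: "('a::complex_hilbert \<Rightarrow> 'a) \<Rightarrow> bool" where
  "bounded_clinear A \<longleftrightarrow> bounded_linear A \<and> (\<forall>c x. A (c *\<^sub>C x) = c *\<^sub>C A x)"

definition adj :: "('a::complex_hilbert \<Rightarrow> 'a) \<Rightarrow> ('a \<Rightarrow> 'a)" where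
  "adj A = (THE B. bounded_clinear B \<and> (\<forall>x y. cinner (A x) y = cinner x (B y)))"

definition positive_op :: "('a::complex_hilbert \<Rightarrow> 'a) \<Rightarrow> bool" where
  "positive_op B \<longleftrightarrow>
     bounded_clinear B \<and> (\<forall>x. cinner (B x) x \<in> \<real> \<and> 0 \<le> Re (cinner (B x) x))"

definition abs_op :: "('a::complex_hilbert \<Rightarrow> 'a) \<Rightarrow> ('a \<Rightarrow> 'a)" where
  "abs_op A = (THE B. positive_op B \<and> B \<circ> B = adj A \<circ> A)"

definition Re_op :: "('a::complex_hilbert \<Rightarrow> 'a) \<Rightarrow> ('a \<Rightarrow> 'a)" where
  "Re_op A = (\<lambda>x. (1 / 2) *\<^sub>C (A x + adj A x))"

definition Im_op :: "('a::complex_hilbert \<Rightarrow> 'a) \<Rightarrow> ('a \<Rightarrow> 'a)" where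
  "Im_op A = (\<lambda>x. (1 / (2 * \<i>)) *\<^sub>C (A x - adj A x))"

text \<open>
  The supremum is taken in \<open>[0, \<infinity>)\<close>: inserting \<open>0\<close> matters only for the zero space, which has
  no unit vectors and where \<open>Sup {}\<close> is unspecified on the reals.
\<close>

definition numerical_radius :: "('a::complex_hilbert \<Rightarrow> 'a) \<Rightarrow> real" where
  "numerical_radius A = Sup (insert 0 {cmod (cinner (A x) x) |x. norm x = 1})"

end

theory Submission
  imports Defs
begin

text \<open>
  Lower bound: with \<open>A = B + i C\<close>, \<open>B\<close> and \<open>C\<close> self-adjoint, the quadratic form of \<open>Re (A\<^sup>2) = B\<^sup>2 - C\<^sup>2\<close>
  at a unit vector is \<open>\<parallel>B x\<parallel>\<^sup>2 - \<parallel>C x\<parallel>\<^sup>2\<close>, and \<open>\<parallel>B\<parallel>\<close>, \<open>\<parallel>C\<parallel>\<close> are at most \<open>w(A)\<close>; hence each of the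
  two terms on the left is at most half of \<open>w(A)\<^sup>2\<close>.

  Upper bound: by the mixed Schwarz inequality \<open>\<bar>\<langle>A x, x\<rangle>\<bar>\<^sup>2 \<le> p q \<le> (p\<^sup>2 + q\<^sup>2) / 2\<close> with
  \<open>p = \<langle>|A| x, x\<rangle>\<close> and \<open>q = \<langle>|A*| x, x\<rangle>\<close>, while \<open>\<langle>(|A| + i |A*|) x, x\<rangle>\<close> and \<open>\<langle>(|A*| + i |A|) x, x\<rangle>\<close> both
  have modulus \<open>sqrt (p\<^sup>2 + q\<^sup>2)\<close>. The mixed Schwarz inequality needs no polar decomposition: since
  \<open>A |A| = |A*| A\<close>, it is the Cauchy-Schwarz inequality for the form of \<open>|A*|\<close> when \<open>x\<close> is in the range
  of \<open>|A|\<close>, and in general one solves \<open>|A| v + e v = x\<close> and lets \<open>e\<close> tend to \<open>0\<close>.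
\<close>

section \<open>Positive operators on real Hilbert spaces\<close>

text \<open>Symmetry is demanded explicitly because over the reals it does not follow from
  nonnegativity of the form. Only the real inner product enters, so square roots can be built
  without complex scalars.\<close>

definition psd_op :: "('a::real_inner \<Rightarrow> 'a) \<Rightarrow> bool" where
  "psd_op P \<longleftrightarrow> bounded_linear P \<and> (\<forall>x y. P x \<bullet> y = x \<bullet> P y) \<and> (\<forall>x. 0 \<le> P x \<bullet> x)"

lemma psd_opD:
  assumes "psd_op P"
  shows "bounded_linear P" "P x \<bullet> y = x \<bullet> P y" "0 \<le> P x \<bullet> x"
  using assms by (auto simp: psd_op_def)

lemma nonneg_quadratic_discriminant:
  fixes a b c :: real
  assumes "\<And>t. 0 \<le> a + 2 * t * b + t\<^sup>2 * c" "0 \<le> c"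
  shows "b\<^sup>2 \<le> a * c"
proof (cases "c = 0")
  case True
  show ?thesis
  proof (rule ccontr)
    assume "\<not> ?thesis"
    then have "b \<noteq> 0" using True by auto
    \<comment> \<open>With \<open>c = 0\<close> the expression is affine in \<open>t\<close>, and
      this \<open>t\<close> gives it the value -1.\<close>
    then show False using assms(1)[of "- (a + 1) / (2 * b)"] True by (simp add: field_simps)
  qed
next
  case False
  then have c: "0 < c" using assms(2) by simp
  have "0 \<le> a + 2 * (- b / c) * b + (- b / c)\<^sup>2 * c" by (rule assms(1))
  also have "\<dots> = a - b\<^sup>2 / c" using c by (simp add: power2_eq_square field_simps)
  finally show ?thesis using c by (simp add: field_simps)
qed

lemma psd_op_Cauchy_Schwarz:
  assumes "psd_op P"
  shows "(P x \<bullet> y)\<^sup>2 \<le> (P x \<bullet> x) * (P y \<bullet> y)"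
proof (rule nonneg_quadratic_discriminant)
  interpret bounded_linear P using assms by (rule psd_opD)
  fix t
  have "P (x + t *\<^sub>R y) \<bullet> (x + t *\<^sub>R y) = P x \<bullet> x + 2 * t * (P x \<bullet> y) + t\<^sup>2 * (P y \<bullet> y)"
    using psd_opD(2)[OF assms, of y x]
    by (simp add: add scaleR inner_add_left inner_add_right power2_eq_square algebra_simps
          inner_commute[of y "P x"])
  then show "0 \<le> P x \<bullet> x + 2 * t * (P x \<bullet> y) + t\<^sup>2 * (P y \<bullet> y)"
    using psd_opD(3)[OF assms, of "x + t *\<^sub>R y"] by simp
qed (rule psd_opD(3)[OF assms])

text \<open>Cauchy-Schwarz for the form of \<open>P\<close>, taken at \<open>y = P x\<close>, bounds
  the fourth power of \<open>norm (P x)\<close> by 0.\<close>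

lemma psd_op_eq_zero:
  assumes "psd_op P" "P x \<bullet> x = 0"
  shows "P x = 0"
  using psd_op_Cauchy_Schwarz[OF assms(1), of x "P x"] assms(2) by simp

text \<open>Polarization expresses \<open>L x \<bullet> y\<close> through the form at
  \<open>x + y\<close> and \<open>x - y\<close>; the parallelogram law adds up the two bounds. The
  choice of \<open>y\<close> along \<open>L x\<close> with the length of \<open>x\<close> gives the
  norm.\<close>

lemma symmetric_norm_le:
  fixes L :: "'a::real_inner \<Rightarrow> 'a"
  assumes "linear L" and sym: "\<And>x y. L x \<bullet> y = x \<bullet> L y"
    and k: "\<And>x. \<bar>L x \<bullet> x\<bar> \<le> k * (norm x)\<^sup>2"
  shows "norm (L x) \<le> k * norm x"
proof (cases "x = 0 \<or> L x = 0")
  case True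
  have "0 \<le> k * norm x"
  proof (cases "x = 0")
    case False
    have "0 \<le> k * (norm x)\<^sup>2" using k[of x] by linarith
    then show ?thesis using False by (simp add: zero_le_mult_iff)
  qed simp
  then show ?thesis using True linear_0[OF assms(1)] by auto
next
  case False
  interpret linear L by fact
  have polar: "4 * (L x \<bullet> y) \<le> 2 * k * ((norm x)\<^sup>2 + (norm y)\<^sup>2)" for y
  proof -
    have "4 * (L x \<bullet> y) = L (x + y) \<bullet> (x + y) - L (x - y) \<bullet> (x - y)"
      using sym[of y x] by (simp add: add diff inner_add_left inner_add_right inner_diff_left
          inner_diff_right inner_commute[of y "L x"])
    also have "\<dots> \<le> k * (norm (x + y))\<^sup>2 + k * (norm (x - y))\<^sup>2"
      using k[of "x + y"] k[of "x - y"] by linarith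
    also have "\<dots> = 2 * k * ((norm x)\<^sup>2 + (norm y)\<^sup>2)"
      by (simp add: power2_norm_eq_inner inner_add_left inner_add_right inner_diff_left
          inner_diff_right algebra_simps inner_commute[of y x])
    finally show ?thesis .
  qed
  have pos: "norm x > 0" "norm (L x) > 0" using False by auto
  have "L x \<bullet> ((norm x / norm (L x)) *\<^sub>R L x) = norm x * norm (L x)"
    using pos by (simp add: power2_norm_eq_inner[symmetric] power2_eq_square[of "norm (L x)"])
  moreover have "norm ((norm x / norm (L x)) *\<^sub>R L x) = norm x" using pos by simp
  ultimately have "4 * (norm x * norm (L x)) \<le> 2 * k * ((norm x)\<^sup>2 + (norm x)\<^sup>2)"
    using polar[of "(norm x / norm (L x)) *\<^sub>R L x"] by (simp only:)
  then have "norm x * norm (L x) \<le> norm x * (k * norm x)"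
    by (simp add: power2_eq_square mult.left_commute)
  then show ?thesis using pos by simp
qed

text \<open>Riesz representation is the case where \<open>L\<close> is the identity.\<close>

lemma coercive_representation:
  fixes L :: "'a::{real_inner,banach} \<Rightarrow> 'a" and f :: "'a \<Rightarrow> real"
  assumes "bounded_linear L" and sym: "\<And>x y. L x \<bullet> y = x \<bullet> L y"
    and e: "0 < e" and coer: "\<And>x. e * (norm x)\<^sup>2 \<le> L x \<bullet> x" and "bounded_linear f"
  shows "\<exists>v. \<forall>y. L v \<bullet> y = f y"
proof -
  interpret L: bounded_linear L by fact
  interpret f: bounded_linear f by fact
  \<comment> \<open>Direct method: a minimizer of the energy \<open>J\<close> solves the
    equation.\<close>
  define J where "J x = L x \<bullet> x - 2 * f x" for x
  obtain K where K: "\<And>x. \<bar>f x\<bar> \<le> norm x * K" using f.bounded by auto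
  have lower: "- (K\<^sup>2 / e) \<le> J x" for x
  proof -
    have "e * (- (K\<^sup>2 / e)) \<le> e * (e * (norm x)\<^sup>2 - 2 * (norm x * K))"
      using zero_le_power2[of "e * norm x - K"] e by (simp add: power2_eq_square algebra_simps)
    then have "- (K\<^sup>2 / e) \<le> e * (norm x)\<^sup>2 - 2 * (norm x * K)"
      using e by (simp only: mult_le_cancel_left_pos)
    then show ?thesis using coer[of x] K[of x] unfolding J_def by linarith
  qed
  have bdd: "bdd_below (range J)" using lower by (auto intro!: bdd_belowI2)
  define m where "m = Inf (range J)"
  have m: "m \<le> J x" for x unfolding m_def by (rule cInf_lower[OF _ bdd]) simp
  \<comment> \<open>Parallelogram law for the form of \<open>L\<close>: the midpoint has energy at
    least \<open>m\<close>, so points with energy near \<open>m\<close> are close together and a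
    minimizing sequence is Cauchy.\<close>
  have par: "e * (norm (x - y))\<^sup>2 \<le> 2 * (J x - m) + 2 * (J y - m)" for x y
  proof -
    have "J ((1/2) *\<^sub>R (x + y)) = (1/4) * (L (x + y) \<bullet> (x + y)) - f (x + y)"
      by (simp add: J_def L.scaleR f.scaleR)
    then have "L (x - y) \<bullet> (x - y) = 2 * J x + 2 * J y - 4 * J ((1/2) *\<^sub>R (x + y))"
      by (simp add: J_def L.add L.diff f.add inner_add_left inner_add_right
          inner_diff_left inner_diff_right algebra_simps)
    then have "e * (norm (x - y))\<^sup>2 \<le> 2 * J x + 2 * J y - 4 * J ((1/2) *\<^sub>R (x + y))"
      using coer[of "x - y"] by (simp only:)
    also have "\<dots> \<le> 2 * J x + 2 * J y - 4 * m" using m by (intro diff_left_mono) simp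
    finally show ?thesis by simp
  qed
  have "\<exists>x. J x < m + 1 / Suc n" for n
    using cInf_lessD[of "range J" "m + 1 / Suc n"] by (auto simp: m_def)
  then obtain X where X: "\<And>n. J (X n) < m + 1 / Suc n" by metis
  have "Cauchy X"
  proof (rule CauchyI)
    fix d :: real assume d: "0 < d"
    \<comment> \<open>\<open>N\<close> makes \<open>4 / Suc N < e * d\<^sup>2\<close>, where
      \<open>4 / Suc N\<close> is what \<open>par\<close> yields for two terms of index at least
      \<open>N\<close>.\<close>
    then obtain N where N: "4 / (e * d\<^sup>2) < real N" using reals_Archimedean2 by blast
    have "norm (X i - X j) < d" if "i \<ge> N" "j \<ge> N" for i j
    proof -
      define s where "s = 1 / real (Suc N)"
      have close: "J (X k) < m + s" if "k \<ge> N" for k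
      proof -
        have "1 / Suc k \<le> s" unfolding s_def using that by (simp add: frac_le)
        then show ?thesis using X[of k] by (meson add_left_mono less_le_trans)
      qed
      have "2 * (J (X i) - m) + 2 * (J (X j) - m) < 4 * s"
        using close[OF that(1)] close[OF that(2)] by (simp add: algebra_simps)
      with par have "e * (norm (X i - X j))\<^sup>2 < 4 * s" by (rule le_less_trans)
      also have "\<dots> < e * d\<^sup>2"
      proof -
        have "4 < real N * (e * d\<^sup>2)" using N d e by (simp add: field_simps)
        also have "\<dots> \<le> real (Suc N) * (e * d\<^sup>2)" using e by (intro mult_right_mono) auto
        finally show ?thesis by (simp add: s_def field_simps)
      qed
      finally have "(norm (X i - X j))\<^sup>2 < d\<^sup>2" using e by simp
      then show ?thesis using d by (simp add: power_less_imp_less_base)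
    qed
    then show "\<exists>M. \<forall>i\<ge>M. \<forall>j\<ge>M. norm (X i - X j) < d" by blast
  qed
  then obtain v where v: "X \<longlonglongrightarrow> v" using Cauchy_convergent convergent_def by blast
  have "(\<lambda>n. J (X n)) \<longlonglongrightarrow> J v"
    unfolding J_def by (intro tendsto_intros L.tendsto f.tendsto v)
  moreover have "(\<lambda>n. m + 1 / Suc n) \<longlonglongrightarrow> m + 0"
    by (intro tendsto_intros LIMSEQ_Suc lim_1_over_n)
  ultimately have "J v \<le> m" using X by (force intro: LIMSEQ_le less_imp_le)
  have "L v \<bullet> y = f y" for y
  proof -
    \<comment> \<open>The quadratic in \<open>t\<close> is
      \<open>J (v + t *\<^sub>R y) - J v\<close>. It is nonnegative without constant term, so its
      linear coefficient vanishes.\<close>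
    have "(L v \<bullet> y - f y)\<^sup>2 \<le> 0 * (L y \<bullet> y)"
    proof (rule nonneg_quadratic_discriminant)
      fix t
      have "J v \<le> J (v + t *\<^sub>R y)" using m \<open>J v \<le> m\<close> by (rule order_trans[rotated])
      then show "0 \<le> 0 + 2 * t * (L v \<bullet> y - f y) + t\<^sup>2 * (L y \<bullet> y)"
        using sym[of y v] by (simp add: J_def L.add L.scaleR f.add f.scaleR inner_add_left
            inner_add_right power2_eq_square algebra_simps inner_commute[of y "L v"])
      show "0 \<le> L y \<bullet> y" using coer[of y] e by (meson mult_nonneg_nonneg order_trans less_imp_le zero_le_power2)
    qed
    then show ?thesis by simp
  qed
  then show ?thesis by blast
qed

text \<open>\<open>P\<close> and \<open>Q\<close> stand for the absolute values of \<open>A\<close>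
  and of its adjoint; \<open>isom\<close> expresses that the square of \<open>P\<close> is the
  adjoint of \<open>A\<close> composed with \<open>A\<close>. The regularization by \<open>e\<close>
  replaces an inverse of \<open>P\<close>, which may not exist.\<close>

lemma mixed_Schwarz_real:
  fixes A P Q :: "'a::{real_inner,banach} \<Rightarrow> 'a"
  assumes "bounded_linear A" and P: "psd_op P" and Q: "psd_op Q"
    and isom: "\<And>u v. A u \<bullet> A v = P u \<bullet> P v" and inter: "\<And>u. A (P u) = Q (A u)"
  shows "(A x \<bullet> y)\<^sup>2 \<le> (P x \<bullet> x) * (Q y \<bullet> y)"
proof -
  interpret A: bounded_linear A by fact
  interpret P: bounded_linear P using P by (rule psd_opD)
  have "\<bar>A x \<bullet> y\<bar> \<le> sqrt (P x \<bullet> x) * sqrt (Q y \<bullet> y) + e * (norm x * norm y)" if e: "0 < e" for e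
  proof -
    have "\<exists>v. \<forall>y. (P v + e *\<^sub>R v) \<bullet> y = x \<bullet> y"
      using e psd_opD(2,3)[OF P]
      by (intro coercive_representation[where e = e] bounded_linear_intros P.bounded_linear_axioms)
        (auto simp: inner_add_left inner_add_right power2_norm_eq_inner
           intro: bounded_linear_add bounded_linear_scaleR_right P.bounded_linear_axioms)
    then obtain v where "\<forall>y. (P v + e *\<^sub>R v) \<bullet> y = x \<bullet> y" by blast
    then have v: "x = P v + e *\<^sub>R v" by (simp add: vector_eq_rdot)
    have PP: "P (P v) \<bullet> v = P v \<bullet> P v" by (rule psd_opD(2)[OF P])
    have nonneg: "0 \<le> P v \<bullet> v" "0 \<le> P (P v) \<bullet> P v" by (rule psd_opD(3)[OF P])+
    \<comment> \<open>Expanding \<open>x = P v + e *\<^sub>R v\<close> leaves only nonnegative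
      terms, so \<open>x\<close> dominates \<open>P v\<close>: in norm here, in the form of
      \<open>P\<close> below.\<close>
    have "(norm x)\<^sup>2 = (norm (P v))\<^sup>2 + 2 * e * (P v \<bullet> v) + e\<^sup>2 * (norm v)\<^sup>2"
      unfolding power2_norm_eq_inner v
      by (simp add: inner_add_left inner_add_right algebra_simps power2_eq_square
          inner_commute[of v "P v"])
    then have "(norm (P v))\<^sup>2 \<le> (norm x)\<^sup>2" using e nonneg by simp
    then have Pv: "norm (P v) \<le> norm x" by (rule power2_le_imp_le) simp
    have Av: "norm (A v) \<le> norm x" using Pv isom[of v v] by (simp add: norm_eq_sqrt_inner)
    have "P x \<bullet> x = P (P v) \<bullet> P v + 2 * e * (P v \<bullet> P v) + e\<^sup>2 * (P v \<bullet> v)"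
      by (simp add: v P.add P.scaleR inner_add_left inner_add_right algebra_simps power2_eq_square PP)
    then have Px: "P (P v) \<bullet> P v \<le> P x \<bullet> x" using e nonneg by simp
    have "Q (A v) \<bullet> A v = P (P v) \<bullet> P v" by (simp flip: inter add: isom)
    then have "(Q (A v) \<bullet> y)\<^sup>2 \<le> (P x \<bullet> x) * (Q y \<bullet> y)"
      using psd_op_Cauchy_Schwarz[OF Q, of "A v" y] Px psd_opD(3)[OF Q, of y]
      by (metis mult_right_mono order_trans)
    then have "\<bar>Q (A v) \<bullet> y\<bar> \<le> sqrt (P x \<bullet> x) * sqrt (Q y \<bullet> y)"
      by (metis real_sqrt_abs real_sqrt_le_mono real_sqrt_mult)
    moreover have "\<bar>A v \<bullet> y\<bar> \<le> norm x * norm y"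
      using Cauchy_Schwarz_ineq2[of "A v" y] Av by (meson mult_right_mono norm_ge_zero order_trans)
    then have "\<bar>e * (A v \<bullet> y)\<bar> \<le> e * (norm x * norm y)" using e by (simp add: abs_mult)
    \<comment> \<open>Cauchy-Schwarz for \<open>Q\<close> handles the part \<open>P v\<close> of
      \<open>x\<close>; the remainder \<open>e *\<^sub>R v\<close> costs at most
      \<open>e * (norm x * norm y)\<close>.\<close>
    moreover have "A x \<bullet> y = Q (A v) \<bullet> y + e * (A v \<bullet> y)"
      by (simp add: v A.add A.scaleR inner_add_left inter)
    ultimately show ?thesis by linarith
  qed note bound = this
  have "\<bar>A x \<bullet> y\<bar> \<le> sqrt (P x \<bullet> x) * sqrt (Q y \<bullet> y)"
  proof (rule field_le_epsilon)
    fix d :: real assume d: "0 < d"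
    \<comment> \<open>The summand 1 keeps the divisor positive when \<open>x\<close> or
      \<open>y\<close> is zero.\<close>
    define c where "c = norm x * norm y + 1"
    have c: "0 < c" by (simp add: c_def add_nonneg_pos)
    have "d / c * (norm x * norm y) \<le> d / c * c" using c d by (intro mult_left_mono) (auto simp: c_def)
    then show "\<bar>A x \<bullet> y\<bar> \<le> sqrt (P x \<bullet> x) * sqrt (Q y \<bullet> y) + d"
      using bound[of "d / c"] c d by simp
  qed
  then have "(A x \<bullet> y)\<^sup>2 \<le> (sqrt (P x \<bullet> x) * sqrt (Q y \<bullet> y))\<^sup>2"
    by (metis abs_ge_zero power2_abs power_mono)
  then show ?thesis using psd_opD(3)[OF P] psd_opD(3)[OF Q] by (simp add: power_mult_distrib)
qed

section \<open>Square roots of positive operators\<close>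

text \<open>Fixed-point iteration for \<open>2 B = X + B\<^sup>2\<close>; the solution sought is 1
  minus the square root of \<open>1 - X\<close>. Every iterate is a polynomial in
  \<open>X\<close>.\<close>

primrec sqrt_iter :: "('a::real_vector \<Rightarrow> 'a) \<Rightarrow> nat \<Rightarrow> 'a \<Rightarrow> 'a" where
  "sqrt_iter X 0 = (\<lambda>x. 0)"
| "sqrt_iter X (Suc n) = (\<lambda>x. (1/2) *\<^sub>R (X x + sqrt_iter X n (sqrt_iter X n x)))"

text \<open>The same iteration for the scalar \<open>X = 1\<close>. It dominates the iterates of
  every contraction, and their increments.\<close>

primrec sqrt_majorant :: "nat \<Rightarrow> real" where
  "sqrt_majorant 0 = 0"
| "sqrt_majorant (Suc n) = (1 + (sqrt_majorant n)\<^sup>2) / 2"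

lemma sqrt_majorant_bounds: "0 \<le> sqrt_majorant n" "sqrt_majorant n \<le> 1"
proof (induction n)
  case (Suc n)
  {
    case 2
    then show ?case using Suc power_le_one[of "sqrt_majorant n" 2] by simp
  }
qed auto

text \<open>The increment equals \<open>(1 - sqrt_majorant n)\<^sup>2 / 2\<close>.\<close>

lemma sqrt_majorant_mono: "sqrt_majorant n \<le> sqrt_majorant (Suc n)"
  using zero_le_power2[of "sqrt_majorant n - 1"] by (simp add: power2_eq_square algebra_simps)

lemma convergent_sqrt_majorant: "convergent sqrt_majorant"
proof (rule Bseq_monoseq_convergent)
  show "Bseq sqrt_majorant" using sqrt_majorant_bounds by (intro BseqI'[of _ 1]) auto
  show "monoseq sqrt_majorant" using sqrt_majorant_mono by (simp add: monoseq_Suc del: sqrt_majorant.simps)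
qed

lemma linear_sqrt_iter:
  assumes "linear X"
  shows "linear (sqrt_iter X n)"
proof (induction n)
  case (Suc n)
  show ?case
    by (rule linearI) (simp_all add: linear_add[OF assms] linear_scale[OF assms] linear_add[OF Suc]
        linear_scale[OF Suc] algebra_simps)
qed (simp add: linear_iff)

text \<open>The iterates are the same polynomials in \<open>X\<close> and in \<open>Y\<close>. The
  case \<open>X = Y\<close> yields commutation.\<close>

lemma sqrt_iter_intertwine:
  assumes "linear A" "\<And>u. A (X u) = Y (A u)"
  shows "A (sqrt_iter X n u) = sqrt_iter Y n (A u)"
proof (induction n arbitrary: u)
  case (Suc n)
  then show ?case by (simp add: linear_add[OF assms(1)] linear_scale[OF assms(1)] assms(2))
qed (simp add: linear_0[OF assms(1)])

lemma sqrt_iter_symmetric: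
  assumes "\<And>x y. X x \<bullet> y = x \<bullet> X y"
  shows "sqrt_iter X n x \<bullet> y = x \<bullet> sqrt_iter X n y"
  by (induction n arbitrary: x y) (simp_all add: inner_add_left inner_add_right assms)

section \<open>Convergence of the iteration for contractions\<close>

context
  fixes X :: "'a::{real_inner,banach} \<Rightarrow> 'a"
  assumes lin: "linear X" and contr: "\<And>x. norm (X x) \<le> norm x"
begin

lemma norm_sqrt_iter: "norm (sqrt_iter X n x) \<le> sqrt_majorant n * norm x"
proof (induction n arbitrary: x)
  case (Suc n)
  have "norm (sqrt_iter X n (sqrt_iter X n x)) \<le> sqrt_majorant n * (sqrt_majorant n * norm x)"
    using Suc.IH[of "sqrt_iter X n x"] Suc.IH[of x] sqrt_majorant_bounds(1)[of n]
    by (meson mult_left_mono order_trans)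
  then have "norm (X x + sqrt_iter X n (sqrt_iter X n x)) \<le> norm x + (sqrt_majorant n)\<^sup>2 * norm x"
    using contr[of x] norm_triangle_ineq[of "X x" "sqrt_iter X n (sqrt_iter X n x)"]
    by (simp add: power2_eq_square mult.assoc)
  then show ?case unfolding sqrt_iter.simps sqrt_majorant.simps norm_scaleR by (simp add: field_simps)
qed simp

lemma norm_sqrt_iter_le: "norm (sqrt_iter X n x) \<le> norm x"
  using norm_sqrt_iter[of n x] mult_right_mono[OF sqrt_majorant_bounds(2), of "norm x" n] by simp

text \<open>Intertwining is used twice: \<open>X\<close> commutes with its iterates, and therefore
  each iterate, commuting with \<open>X\<close>, commutes with the others.\<close>

lemma sqrt_iter_commute: "sqrt_iter X m (sqrt_iter X n x) = sqrt_iter X n (sqrt_iter X m x)"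
proof -
  have "X (sqrt_iter X m u) = sqrt_iter X m (X u)" for u
    by (rule sqrt_iter_intertwine[OF lin]) simp
  then show ?thesis by (intro sqrt_iter_intertwine linear_sqrt_iter lin) simp
qed

text \<open>
  As the iterates commute, \<open>B\<^sub>n\<^sub>+\<^sub>2 - B\<^sub>n\<^sub>+\<^sub>1 = (B\<^sub>n\<^sub>+\<^sub>1 + B\<^sub>n) (B\<^sub>n\<^sub>+\<^sub>1 - B\<^sub>n) / 2\<close>, and the majorant
  obeys the same recursion.
\<close>

lemma norm_sqrt_iter_diff:
  "norm (sqrt_iter X (Suc n) x - sqrt_iter X n x) \<le> (sqrt_majorant (Suc n) - sqrt_majorant n) * norm x"
proof (induction n)
  case 0
  then show ?case using contr[of x] by simp
next
  case (Suc n)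
  define B b where "B = sqrt_iter X" and "b = sqrt_majorant"
  define D where "D = B (Suc n) x - B n x"
  have D: "norm D \<le> (b (Suc n) - b n) * norm x" using Suc by (simp only: D_def B_def b_def)
  have lB: "linear (B k)" for k unfolding B_def by (rule linear_sqrt_iter[OF lin])
  have nB: "norm (B k D) \<le> b k * ((b (Suc n) - b n) * norm x)" for k
    using norm_sqrt_iter[of k D] D sqrt_majorant_bounds(1)[of k] unfolding B_def b_def
    by (meson mult_left_mono order_trans)
  have rec: "B (Suc k) x = (1/2) *\<^sub>R (X x + B k (B k x))" for k by (simp add: B_def)
  have recb: "b (Suc k) = (1 + (b k)\<^sup>2) / 2" for k by (simp add: b_def)
  have "B (Suc (Suc n)) x - B (Suc n) x = (1/2) *\<^sub>R (B (Suc n) D + B n D)"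
    \<comment> \<open>Under \<open>\<lambda>z. _ - z\<close> the recursion rewrites only the
      subtracted term; elsewhere \<open>B (Suc n)\<close> has to survive as a factor.\<close>
    unfolding rec[of "Suc n"] rec[of n, THEN arg_cong, of "\<lambda>z. _ - z"]
    using sqrt_iter_commute[of n "Suc n" x]
    by (simp add: D_def linear_diff[OF lB] B_def[symmetric] algebra_simps del: sqrt_iter.simps)
  moreover have "norm (B (Suc n) D + B n D) \<le> (b (Suc n) + b n) * ((b (Suc n) - b n) * norm x)"
    using norm_triangle_mono[OF nB nB] by (simp add: distrib_right)
  ultimately have "norm (B (Suc (Suc n)) x - B (Suc n) x) \<le> (1/2) * ((b (Suc n) + b n) * ((b (Suc n) - b n) * norm x))"
    by simp
  also have "\<dots> = (b (Suc (Suc n)) - b (Suc n)) * norm x"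
    unfolding recb[of "Suc n"] recb[of n, THEN arg_cong, of "\<lambda>z. _ - z"]
    by (simp add: power2_eq_square algebra_simps)
  finally show ?case by (simp only: B_def b_def)
qed

definition sqrt_limit :: "'a \<Rightarrow> 'a" where
  "sqrt_limit x = lim (\<lambda>n. sqrt_iter X n x)"

text \<open>The increments are dominated by those of the majorant, whose series telescopes and
  converges; completeness then gives a limit at each \<open>x\<close>.\<close>

lemma LIMSEQ_sqrt_iter: "(\<lambda>n. sqrt_iter X n x) \<longlonglongrightarrow> sqrt_limit x"
proof -
  have "summable (\<lambda>n. (sqrt_majorant (Suc n) - sqrt_majorant n) * norm x)"
    using convergent_sqrt_majorant telescope_summable
    by (intro summable_mult2) (auto simp: convergent_def simp del: sqrt_majorant.simps)
  then have "summable (\<lambda>n. sqrt_iter X (Suc n) x - sqrt_iter X n x)"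
    by (rule summable_comparison_test'[where N = 0]) (rule norm_sqrt_iter_diff)
  then have "convergent (\<lambda>n. \<Sum>k<n. sqrt_iter X (Suc k) x - sqrt_iter X k x)"
    by (rule summable_iff_convergent[THEN iffD1])
  then show ?thesis unfolding sqrt_limit_def
    by (subst (asm) sum_lessThan_telescope) (simp add: convergent_LIMSEQ_iff)
qed

end

lemma sqrt_limit_intertwine:
  fixes A X Y :: "'a::{real_inner,banach} \<Rightarrow> 'a"
  assumes X: "linear X" "\<And>x. norm (X x) \<le> norm x" and Y: "linear Y" "\<And>x. norm (Y x) \<le> norm x"
    and A: "bounded_linear A" and inter: "\<And>u. A (X u) = Y (A u)"
  shows "A (sqrt_limit X u) = sqrt_limit Y (A u)"
proof (rule LIMSEQ_unique)
  interpret A: bounded_linear A by fact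
  show "(\<lambda>n. A (sqrt_iter X n u)) \<longlonglongrightarrow> A (sqrt_limit X u)"
    by (intro A.tendsto LIMSEQ_sqrt_iter X)
  show "(\<lambda>n. A (sqrt_iter X n u)) \<longlonglongrightarrow> sqrt_limit Y (A u)"
    unfolding sqrt_iter_intertwine[where A = A and X = X and Y = Y, OF A.linear_axioms inter]
    by (intro LIMSEQ_sqrt_iter Y)
qed

lemma linear_sqrt_limit:
  fixes X :: "'a::{real_inner,banach} \<Rightarrow> 'a"
  assumes X: "linear X" "\<And>x. norm (X x) \<le> norm x"
  shows "linear (sqrt_limit X)"
proof (rule linearI)
  note lim = LIMSEQ_sqrt_iter[OF X]
  show "sqrt_limit X (x + y) = sqrt_limit X x + sqrt_limit X y" for x y
    using lim[of "x + y"] tendsto_add[OF lim lim, of x y]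
    by (simp add: linear_add[OF linear_sqrt_iter[OF X(1)]] LIMSEQ_unique)
  show "sqrt_limit X (r *\<^sub>R x) = r *\<^sub>R sqrt_limit X x" for r x
    using lim[of "r *\<^sub>R x"] tendsto_scaleR[OF tendsto_const lim, of r x]
    by (simp add: linear_scale[OF linear_sqrt_iter[OF X(1)]] LIMSEQ_unique)
qed

lemma norm_sqrt_limit_le:
  fixes X :: "'a::{real_inner,banach} \<Rightarrow> 'a"
  assumes X: "linear X" "\<And>x. norm (X x) \<le> norm x"
  shows "norm (sqrt_limit X x) \<le> norm x"
  using tendsto_norm[OF LIMSEQ_sqrt_iter[OF X]] by (rule LIMSEQ_le_const2) (simp add: norm_sqrt_iter_le[OF X])

lemma sqrt_limit_symmetric:
  fixes X :: "'a::{real_inner,banach} \<Rightarrow> 'a"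
  assumes X: "linear X" "\<And>x. norm (X x) \<le> norm x" and sym: "\<And>x y. X x \<bullet> y = x \<bullet> X y"
  shows "sqrt_limit X x \<bullet> y = x \<bullet> sqrt_limit X y"
proof (rule LIMSEQ_unique)
  show "(\<lambda>n. sqrt_iter X n x \<bullet> y) \<longlonglongrightarrow> sqrt_limit X x \<bullet> y"
    by (intro tendsto_intros LIMSEQ_sqrt_iter X)
  show "(\<lambda>n. sqrt_iter X n x \<bullet> y) \<longlonglongrightarrow> x \<bullet> sqrt_limit X y"
    unfolding sqrt_iter_symmetric[OF sym] by (intro tendsto_intros LIMSEQ_sqrt_iter X)
qed

lemma sqrt_limit_fixpoint:
  fixes X :: "'a::{real_inner,banach} \<Rightarrow> 'a"
  assumes X: "linear X" "\<And>x. norm (X x) \<le> norm x"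
  shows "2 *\<^sub>R sqrt_limit X x = X x + sqrt_limit X (sqrt_limit X x)"
proof -
  note lim = LIMSEQ_sqrt_iter[OF X]
  let ?S = "sqrt_limit X"
  \<comment> \<open>Operator and argument both vary with \<open>n\<close>. As the iterates do not
    increase norms, replacing the inner one by its limit costs at most
    \<open>norm (sqrt_iter X n x - ?S x)\<close>.\<close>
  have "(\<lambda>n. sqrt_iter X n (sqrt_iter X n x - ?S x)) \<longlonglongrightarrow> 0"
  proof (rule Lim_null_comparison)
    show "\<forall>\<^sub>F n in sequentially. norm (sqrt_iter X n (sqrt_iter X n x - ?S x)) \<le> norm (sqrt_iter X n x - ?S x)"
      by (simp add: norm_sqrt_iter_le[OF X])
    show "(\<lambda>n. norm (sqrt_iter X n x - ?S x)) \<longlonglongrightarrow> 0"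
      using lim[of x] by (simp add: tendsto_norm_zero LIM_zero)
  qed
  from tendsto_add[OF this lim[of "?S x"]]
  have "(\<lambda>n. sqrt_iter X n (sqrt_iter X n x)) \<longlonglongrightarrow> ?S (?S x)"
    by (simp add: linear_diff[OF linear_sqrt_iter[OF X(1)]])
  then have "(\<lambda>n. X x + sqrt_iter X n (sqrt_iter X n x)) \<longlonglongrightarrow> X x + ?S (?S x)"
    by (intro tendsto_intros)
  moreover have "(\<lambda>n. 2 *\<^sub>R sqrt_iter X (Suc n) x) \<longlonglongrightarrow> 2 *\<^sub>R ?S x"
    by (intro tendsto_intros LIMSEQ_Suc lim)
  ultimately show ?thesis by (simp add: LIMSEQ_unique scaleR_add_right[symmetric] del: scaleR_add_right)
qed

text \<open>\<open>(1 - B)\<^sup>2 = 1 - X\<close> whenever \<open>2 B = X + B\<^sup>2\<close>; the constant \<open>c\<close> only serves to bound \<open>T\<close>.\<close>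

definition op_sqrt :: "real \<Rightarrow> ('a::{real_inner,banach} \<Rightarrow> 'a) \<Rightarrow> 'a \<Rightarrow> 'a" where
  "op_sqrt c T x = sqrt c *\<^sub>R (x - sqrt_limit (\<lambda>x. x - (1 / c) *\<^sub>R T x) x)"

text \<open>The form of \<open>T / c\<close> lies between 0 and that of the identity, hence so does
  the form of \<open>X\<close>; a symmetric operator is bounded by its form.\<close>

lemma contraction_of_psd_op:
  fixes T :: "'a::real_inner \<Rightarrow> 'a"
  assumes T: "psd_op T" and c: "0 < c" and bound: "\<And>x. T x \<bullet> x \<le> c * (norm x)\<^sup>2"
  defines "X \<equiv> \<lambda>x. x - (1 / c) *\<^sub>R T x"
  shows "linear X" "X x \<bullet> y = x \<bullet> X y" "norm (X x) \<le> norm x"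
proof -
  interpret T: bounded_linear T using T by (rule psd_opD)
  show lin: "linear X" by (rule linearI) (simp_all add: X_def T.add T.scaleR algebra_simps)
  show sym: "X x \<bullet> y = x \<bullet> X y" for x y
    by (simp add: X_def inner_diff_left inner_diff_right psd_opD(2)[OF T])
  have "\<bar>X x \<bullet> x\<bar> \<le> 1 * (norm x)\<^sup>2" for x
  proof -
    have "0 \<le> (1 / c) * (T x \<bullet> x)" using c psd_opD(3)[OF T] by simp
    moreover have "(1 / c) * (T x \<bullet> x) \<le> (norm x)\<^sup>2"
      using bound[of x] c by (simp add: field_simps)
    ultimately show ?thesis by (simp add: X_def inner_diff_left power2_norm_eq_inner)
  qed
  from symmetric_norm_le[OF lin sym this] show "norm (X x) \<le> norm x" by simp
qed

text \<open>Positivity holds because \<open>sqrt_limit\<close> does not increase norms. The square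
  comes from the fixed-point equation for \<open>X = 1 - T / c\<close>, with \<open>sqrt c\<close>
  undoing the scaling.\<close>

lemma op_sqrt:
  fixes T :: "'a::{real_inner,banach} \<Rightarrow> 'a"
  assumes T: "psd_op T" and c: "0 < c" and bound: "\<And>x. T x \<bullet> x \<le> c * (norm x)\<^sup>2"
  shows psd_op_op_sqrt: "psd_op (op_sqrt c T)" and op_sqrt_op_sqrt: "op_sqrt c T (op_sqrt c T x) = T x"
proof -
  define X where "X = (\<lambda>x. x - (1 / c) *\<^sub>R T x)"
  have X: "linear X" "norm (X x) \<le> norm x" and sym: "X x \<bullet> y = x \<bullet> X y" for x y
    unfolding X_def by (rule contraction_of_psd_op[OF T c bound])+
  define S where "S = sqrt_limit X"
  have R: "op_sqrt c T = (\<lambda>x. sqrt c *\<^sub>R (x - S x))" by (simp add: fun_eq_iff op_sqrt_def S_def X_def)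
  have S: "linear S" "norm (S x) \<le> norm x" "S x \<bullet> y = x \<bullet> S y" for x y
    unfolding S_def by (rule linear_sqrt_limit norm_sqrt_limit_le sqrt_limit_symmetric X sym)+
  have "bounded_linear S"
    using S(1,2) by (intro bounded_linear_intro[where K = 1]) (simp_all add: linear_add linear_scale)
  then have "bounded_linear (op_sqrt c T)"
    unfolding R by (intro bounded_linear_const_scaleR bounded_linear_sub bounded_linear_ident)
  moreover have "0 \<le> op_sqrt c T x \<bullet> x" for x
  proof -
    have "S x \<bullet> x \<le> norm x * norm x"
      using norm_cauchy_schwarz[of "S x" x] S(2)[of x] by (meson mult_right_mono norm_ge_zero order_trans)
    then show ?thesis using c by (simp add: R inner_diff_left power2_norm_eq_inner[symmetric] power2_eq_square)
  qed
  ultimately show "psd_op (op_sqrt c T)"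
    by (simp add: psd_op_def R inner_diff_left inner_diff_right S(3))
  have "S (S x) = 2 *\<^sub>R S x - X x" using sqrt_limit_fixpoint[OF X, of x] by (simp add: S_def)
  then have "x - S x - S (x - S x) = (1 / c) *\<^sub>R T x"
    by (simp add: linear_diff[OF S(1)] X_def scaleR_2)
  then show "op_sqrt c T (op_sqrt c T x) = T x"
    using c by (simp add: R linear_scale[OF S(1)] scaleR_diff_right[symmetric] del: scaleR_diff_right)
qed

text \<open>Sharing \<open>c\<close> makes \<open>A\<close> intertwine \<open>1 - T1 / c\<close>
  with \<open>1 - T2 / c\<close>. This serves both for operators commuting with a single
  \<open>T\<close> and for relating the absolute values of \<open>A\<close> and
  \<open>adj A\<close>.\<close>

lemma op_sqrt_intertwine:
  fixes A T1 T2 :: "'a::{real_inner,banach} \<Rightarrow> 'a"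
  assumes c: "0 < c"
    and T1: "psd_op T1" "\<And>x. T1 x \<bullet> x \<le> c * (norm x)\<^sup>2"
    and T2: "psd_op T2" "\<And>x. T2 x \<bullet> x \<le> c * (norm x)\<^sup>2"
    and A: "bounded_linear A" and inter: "\<And>u. A (T1 u) = T2 (A u)"
  shows "A (op_sqrt c T1 u) = op_sqrt c T2 (A u)"
proof -
  interpret A: bounded_linear A by fact
  have "A (sqrt_limit (\<lambda>x. x - (1 / c) *\<^sub>R T1 x) u) = sqrt_limit (\<lambda>x. x - (1 / c) *\<^sub>R T2 x) (A u)"
    by (intro sqrt_limit_intertwine A contraction_of_psd_op[OF T1(1) c T1(2)]
        contraction_of_psd_op[OF T2(1) c T2(2)]) (simp add: A.diff A.scaleR inter)
  then show ?thesis by (simp add: op_sqrt_def A.diff A.scaleR)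
qed

text \<open>For \<open>y = P x - S x\<close> commutation gives \<open>P y + S y = 0\<close>. Both
  forms then vanish at \<open>y\<close>, so \<open>P y = S y = 0\<close>, and symmetry yields
  \<open>y \<bullet> y = 0\<close>.\<close>

lemma psd_op_sqrt_unique:
  assumes P: "psd_op P" and S: "psd_op S" and sq: "\<And>x. P (P x) = S (S x)"
    and comm: "\<And>x. P (S x) = S (P x)"
  shows "P = S"
proof
  fix x
  interpret P: bounded_linear P using P by (rule psd_opD)
  interpret S: bounded_linear S using S by (rule psd_opD)
  define y where "y = P x - S x"
  have "P y + S y = 0" by (simp add: y_def P.diff S.diff sq comm)
  then have "P y \<bullet> y + S y \<bullet> y = 0" by (simp flip: inner_add_left)
  then have "P y \<bullet> y = 0" "S y \<bullet> y = 0" using psd_opD(3)[OF P, of y] psd_opD(3)[OF S, of y] by linarith+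
  then have "P y = 0" "S y = 0" using psd_op_eq_zero P S by blast+
  moreover have "y \<bullet> y = P y \<bullet> x - S y \<bullet> x"
    by (simp add: psd_opD(2)[OF P] psd_opD(2)[OF S] y_def[symmetric] flip: inner_diff_right)
  ultimately show "P x = S x" by (simp add: y_def)
qed

section \<open>Operators on complex Hilbert spaces\<close>

instance complex_hilbert \<subseteq> banach ..

lemma cinner_add_right: "cinner x (y + z) = cinner x y + cinner x (z::'a::complex_hilbert)"
  by (metis cinner_add_left cinner_commute complex_cnj_add)

lemma cinner_scaleC_right: "cinner x (c *\<^sub>C y) = cnj c * cinner x (y::'a::complex_hilbert)"
  by (metis cinner_commute cinner_scaleC_left complex_cnj_mult)

lemma scaleC_one: "1 *\<^sub>C x = (x::'a::complex_hilbert)"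
  using scaleR_scaleC[of 1 x] by simp

lemma scaleC_minus_one: "(- 1) *\<^sub>C x = - (x::'a::complex_hilbert)"
  using scaleR_scaleC[of "- 1" x] by simp

lemma scaleC_diff_right: "c *\<^sub>C (x - y) = c *\<^sub>C x - c *\<^sub>C (y::'a::complex_hilbert)"
  using scaleC_add_right[of c "x - y" y] by (simp add: algebra_simps)

lemma scaleC_scaleR: "c *\<^sub>C r *\<^sub>R x = r *\<^sub>R c *\<^sub>C (x::'a::complex_hilbert)"
  by (simp add: scaleR_scaleC scaleC_scaleC mult.commute)

lemma Im_cinner: "Im (cinner x y) = - ((\<i> *\<^sub>C x) \<bullet> (y::'a::complex_hilbert))"
  by (simp add: inner_eq_Re_cinner cinner_scaleC_left)

lemma cinner_self: "cinner x x = complex_of_real ((norm (x::'a::complex_hilbert))\<^sup>2)"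
proof (rule complex_eqI)
  show "Im (cinner x x) = Im (complex_of_real ((norm x)\<^sup>2))"
    using arg_cong[OF cinner_commute[of x x], of Im] by simp
qed (simp add: power2_norm_eq_inner inner_eq_Re_cinner)

lemma norm_scaleC: "norm (c *\<^sub>C x) = cmod c * norm (x::'a::complex_hilbert)"
proof -
  have "complex_of_real ((norm (c *\<^sub>C x))\<^sup>2) = c * cnj c * cinner x x"
    by (simp only: cinner_self[symmetric] cinner_scaleC_left cinner_scaleC_right mult_ac)
  also have "\<dots> = complex_of_real ((cmod c * norm x)\<^sup>2)"
    by (simp add: cinner_self complex_norm_square[symmetric] power_mult_distrib del: of_real_power
        flip: of_real_mult)
  finally have "(norm (c *\<^sub>C x))\<^sup>2 = (cmod c * norm x)\<^sup>2" by (simp only: of_real_eq_iff)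
  then show ?thesis by (simp add: power2_eq_iff_nonneg)
qed

lemma bounded_linear_scaleC: "bounded_linear (\<lambda>x::'a::complex_hilbert. c *\<^sub>C x)"
  by (rule bounded_linear_intro[where K = "cmod c"])
    (simp_all add: scaleC_add_right scaleC_scaleR norm_scaleC mult.commute)

text \<open>Rotating \<open>y\<close> by a unit scalar turns the modulus into a real inner product,
  so real estimates carry over to \<open>cinner\<close>.\<close>

lemma cinner_phase:
  obtains c where "cmod c = 1" "x \<bullet> (c *\<^sub>C y) = cmod (cinner x (y::'a::complex_hilbert))"
proof (cases "cinner x y = 0")
  case True
  then show ?thesis using that[of 1] by (simp add: scaleC_one inner_eq_Re_cinner)
next
  case False
  let ?c = "sgn (cinner x y)"
  have "cnj ?c * cinner x y = cmod (cinner x y)"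
    using False by (simp add: sgn_div_norm mult.commute[of "cnj _"] scaleR_conv_of_real field_simps
        complex_norm_square[symmetric] power2_eq_square flip: of_real_mult)
  then show ?thesis using that[of ?c] False
    by (simp add: inner_eq_Re_cinner cinner_scaleC_right norm_sgn)
qed

lemma cmod_cinner_le: "cmod (cinner x y) \<le> norm x * norm (y::'a::complex_hilbert)"
proof -
  obtain c where c: "cmod c = 1" "x \<bullet> (c *\<^sub>C y) = cmod (cinner x y)" by (rule cinner_phase)
  show ?thesis using norm_cauchy_schwarz[of x "c *\<^sub>C y"] c by (simp add: norm_scaleC)
qed

lemma cinner_extensionality: "(\<And>x. cinner x y = cinner x z) \<Longrightarrow> y = (z::'a::complex_hilbert)"
  by (rule vector_eq_ldot[THEN iffD1]) (simp add: inner_eq_Re_cinner)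

lemma bounded_clinearD:
  assumes "bounded_clinear A"
  shows "bounded_linear A" "A (c *\<^sub>C x) = c *\<^sub>C A x"
  using assms by (simp_all add: bounded_clinear_def)

lemma bounded_clinear_compose:
  "bounded_clinear A \<Longrightarrow> bounded_clinear B \<Longrightarrow> bounded_clinear (A \<circ> B)"
  by (simp add: bounded_clinear_def bounded_linear_compose o_def)

lemma bounded_clinear_add:
  "bounded_clinear A \<Longrightarrow> bounded_clinear B \<Longrightarrow> bounded_clinear (\<lambda>x. A x + B x)"
  by (simp add: bounded_clinear_def bounded_linear_add scaleC_add_right)

lemma bounded_clinear_scaleC: "bounded_clinear A \<Longrightarrow> bounded_clinear (\<lambda>x. c *\<^sub>C A x)"
  by (auto simp add: bounded_clinear_def scaleC_scaleC mult.commute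
      intro: bounded_linear_compose[OF bounded_linear_scaleC])

section \<open>Adjoints\<close>

lemma adj_eqI:
  assumes "bounded_clinear B" "\<And>x y. cinner (A x) y = cinner x (B y)"
  shows "adj A = B"
  unfolding adj_def using assms by (intro the_equality) (auto intro: cinner_extensionality)

text \<open>Riesz representation for the real inner product supplies \<open>B\<close>. As
  \<open>A\<close> commutes with \<open>\<i>\<close>, the imaginary part of the identity is its real
  part at \<open>\<i> *\<^sub>C x\<close>.\<close>

lemma adj_exists:
  assumes A: "bounded_clinear A"
  shows "\<exists>B. bounded_clinear B \<and> (\<forall>x y. cinner (A x) y = cinner x (B y))"
proof -
  interpret A: bounded_linear A using A by (rule bounded_clinearD)
  have "\<exists>v. \<forall>x. v \<bullet> x = A x \<bullet> y" for y
    by (rule coercive_representation[where L = "\<lambda>x. x" and e = 1])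
      (auto simp: power2_norm_eq_inner intro: bounded_linear_inner_left_comp A.bounded_linear_axioms bounded_linear_ident)
  then obtain B where "\<And>x y. B y \<bullet> x = A x \<bullet> y" by metis
  then have B: "x \<bullet> B y = A x \<bullet> y" for x y by (metis inner_commute)
  have eq: "cinner (A x) y = cinner x (B y)" for x y
    by (rule complex_eqI) (simp_all add: Im_cinner B bounded_clinearD(2)[OF A] flip: inner_eq_Re_cinner)
  obtain K where K: "\<And>x. norm (A x) \<le> norm x * K" using A.bounded by blast
  have "bounded_linear B"
  proof (rule bounded_linear_intro)
    show "B (x + y) = B x + B y" for x y
      by (rule cinner_extensionality) (simp add: cinner_add_right flip: eq)
    show "B (r *\<^sub>R x) = r *\<^sub>R B x" for r x
      by (rule cinner_extensionality) (simp add: scaleR_scaleC cinner_scaleC_right flip: eq)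
    show "norm (B y) \<le> norm y * K" for y
    \<comment> \<open>The main case cancels \<open>norm (B y)\<close>. \<open>K\<close> comes
      without a sign, so the zero case takes nonnegativity of \<open>norm y * K\<close> from the
      bound on \<open>A y\<close>.\<close>
    proof (cases "B y = 0")
      case True
      have "0 \<le> norm y * K" using K[of y] norm_ge_zero order_trans by blast
      with True show ?thesis by simp
    next
      case False
      have "norm (B y) * norm (B y) = A (B y) \<bullet> y" by (simp add: power2_norm_eq_inner flip: B power2_eq_square)
      also have "\<dots> \<le> norm (B y) * K * norm y"
        using norm_cauchy_schwarz[of "A (B y)" y] K[of "B y"] by (meson mult_right_mono norm_ge_zero order_trans)
      finally have "norm (B y) * norm (B y) \<le> norm (B y) * (norm y * K)" by (simp add: mult_ac)
      then show ?thesis using False by simp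
    qed
  qed
  moreover have "B (c *\<^sub>C x) = c *\<^sub>C B x" for c x
    by (rule cinner_extensionality) (simp add: cinner_scaleC_right flip: eq)
  ultimately show ?thesis using eq unfolding bounded_clinear_def by blast
qed

lemma
  assumes "bounded_clinear A"
  shows bounded_clinear_adj: "bounded_clinear (adj A)"
    and cinner_adj: "cinner (A x) y = cinner x (adj A y)"
  using adj_exists[OF assms] adj_eqI by metis+

lemma cinner_adj_left:
  assumes "bounded_clinear A"
  shows "cinner (adj A x) y = cinner x (A y)"
  by (metis cinner_adj[OF assms] cinner_commute)

lemma inner_adj:
  assumes "bounded_clinear A"
  shows "A x \<bullet> y = x \<bullet> adj A y" "adj A x \<bullet> y = x \<bullet> A y"
  by (simp_all add: inner_eq_Re_cinner cinner_adj[OF assms] cinner_adj_left[OF assms])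

lemma adj_adj: "bounded_clinear A \<Longrightarrow> adj (adj A) = A"
  by (intro adj_eqI cinner_adj_left)

lemma adj_scaleC:
  "bounded_clinear A \<Longrightarrow> adj (\<lambda>x. c *\<^sub>C A x) = (\<lambda>x. cnj c *\<^sub>C adj A x)"
  by (intro adj_eqI bounded_clinear_scaleC bounded_clinear_adj)
    (simp_all add: cinner_adj cinner_scaleC_left cinner_scaleC_right)

section \<open>Positive operators and absolute values\<close>

text \<open>The form is real at \<open>x + \<i> *\<^sub>C y\<close>; the imaginary part of the cross
  terms there is \<open>B y \<bullet> x - B x \<bullet> y\<close>.\<close>

lemma psd_op_positive_op:
  assumes "positive_op B"
  shows "psd_op B"
proof -
  have B: "bounded_clinear B" using assms by (simp add: positive_op_def)
  interpret B: bounded_linear B using B by (rule bounded_clinearD)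
  have im: "Im (cinner (B x) x) = 0" for x using assms by (auto simp: positive_op_def complex_is_Real_iff)
  have "B x \<bullet> y = x \<bullet> B y" for x y
    using im[of "x + \<i> *\<^sub>C y"] im[of x] im[of y]
    by (simp add: B.add bounded_clinearD(2)[OF B] cinner_add_left cinner_add_right cinner_scaleC_left
        cinner_scaleC_right inner_eq_Re_cinner[of "B x"] inner_commute[of x "B y"] inner_eq_Re_cinner[of "B y"])
  moreover have "0 \<le> B x \<bullet> x" for x using assms by (simp add: positive_op_def inner_eq_Re_cinner)
  ultimately show ?thesis by (simp add: psd_op_def B.bounded_linear_axioms)
qed

text \<open>Complex linearity moves the \<open>\<i>\<close> of \<open>Im_cinner\<close> through
  \<open>B\<close>; with symmetry, \<open>Im (cinner (B x) x)\<close> equals its own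
  negative.\<close>

lemma positive_op_psd_op:
  assumes B: "psd_op B" and scale: "\<And>c x. B (c *\<^sub>C x) = c *\<^sub>C B x"
  shows "positive_op B"
proof -
  have "Im (cinner (B x) x) = 0" for x
  proof -
    have "Im (cinner (B x) x) = Im (cinner x (B x))"
      by (simp add: Im_cinner psd_opD(2)[OF B] flip: scale)
    then show ?thesis using arg_cong[OF cinner_commute[of x "B x"], of Im] by simp
  qed
  then show ?thesis using psd_opD(1,3)[OF B]
    by (simp add: positive_op_def bounded_clinear_def scale complex_is_Real_iff inner_eq_Re_cinner)
qed

lemma psd_op_adj_compose:
  assumes A: "bounded_clinear A"
  shows "psd_op (adj A \<circ> A)"
  using bounded_clinearD(1)[OF bounded_clinear_compose[OF bounded_clinear_adj[OF A] A]]
  by (simp add: psd_op_def inner_adj(2)[OF A] inner_adj(1)[OF A, symmetric])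

lemma adj_compose_le:
  assumes A: "bounded_clinear A" and "\<And>x. (norm (A x))\<^sup>2 \<le> c * (norm x)\<^sup>2"
  shows "(adj A \<circ> A) x \<bullet> x \<le> c * (norm x)\<^sup>2"
  using assms(2)[of x] by (simp add: inner_adj[OF A] power2_norm_eq_inner)

text \<open>A positive square root \<open>B\<close> commutes with its square
  \<open>adj A \<circ> A\<close>, hence with the constructed root, and so equals it. The bound
  \<open>c\<close> is left free in order that \<open>A\<close> and \<open>adj A\<close> can share
  one.\<close>

lemma
  assumes A: "bounded_clinear A" and c: "0 < c" and le: "\<And>x. (norm (A x))\<^sup>2 \<le> c * (norm x)\<^sup>2"
  shows abs_op_eq_op_sqrt: "abs_op A = op_sqrt c (adj A \<circ> A)"
    and positive_op_op_sqrt: "positive_op (op_sqrt c (adj A \<circ> A))"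
proof -
  let ?T = "adj A \<circ> A"
  let ?S = "op_sqrt c ?T"
  note T = psd_op_adj_compose[OF A] adj_compose_le[OF A le]
  have S: "psd_op ?S" and sq: "?S (?S x) = ?T x" for x
    using op_sqrt[OF T(1) c T(2)] by blast+
  have comm: "B (?S x) = ?S (B x)" if "bounded_linear B" "\<And>x. B (?T x) = ?T (B x)" for B x
    by (rule op_sqrt_intertwine[where A = B and ?T1.0 = ?T and ?T2.0 = ?T]) (rule c T that)+
  show pos: "positive_op ?S"
  proof (rule positive_op_psd_op[OF S])
    show "?S (a *\<^sub>C x) = a *\<^sub>C ?S x" for a x
      by (rule comm[where B = "\<lambda>x. a *\<^sub>C x", symmetric, OF bounded_linear_scaleC])
        (simp add: bounded_clinearD(2)[OF A] bounded_clinearD(2)[OF bounded_clinear_adj[OF A]])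
  qed
  show "abs_op A = ?S" unfolding abs_op_def
  proof (rule the_equality)
    show "positive_op ?S \<and> ?S \<circ> ?S = ?T" using pos sq by (simp add: fun_eq_iff)
    fix B assume B: "positive_op B \<and> B \<circ> B = ?T"
    then have psd: "psd_op B" and BB: "B (B x) = ?T x" for x
      using psd_op_positive_op by (auto simp: fun_eq_iff)
    show "B = ?S"
    proof (rule psd_op_sqrt_unique[OF psd S])
      show "B (B x) = ?S (?S x)" for x by (simp only: BB sq)
      show "B (?S x) = ?S (B x)" for x
        by (rule comm[OF psd_opD(1)[OF psd]]) (simp only: BB[symmetric])
    qed
  qed
qed

lemma norm_squared_bound:
  assumes "bounded_clinear A"
  obtains c where "0 < c" "\<And>x. (norm (A x))\<^sup>2 \<le> c * (norm x)\<^sup>2"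
proof -
  obtain K where K: "0 < K" "\<And>x. norm (A x) \<le> norm x * K"
    using bounded_linear.pos_bounded[OF bounded_clinearD(1)[OF assms]] by blast
  have "(norm (A x))\<^sup>2 \<le> K\<^sup>2 * (norm x)\<^sup>2" for x
    using power_mono[OF K(2)[of x], of 2] by (simp add: power_mult_distrib mult.commute)
  then show ?thesis using that[of "K\<^sup>2"] K(1) by simp
qed

lemma
  assumes A: "bounded_clinear A"
  shows positive_op_abs_op: "positive_op (abs_op A)"
    and abs_op_abs_op: "abs_op A (abs_op A x) = adj A (A x)"
proof -
  obtain c where c: "0 < c" "\<And>x. (norm (A x))\<^sup>2 \<le> c * (norm x)\<^sup>2" by (rule norm_squared_bound[OF A]) blast
  note eq = abs_op_eq_op_sqrt[OF A c]
  show "positive_op (abs_op A)" unfolding eq by (rule positive_op_op_sqrt[OF A c])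
  show "abs_op A (abs_op A x) = adj A (A x)"
    unfolding eq
    by (rule trans[OF op_sqrt_op_sqrt[OF psd_op_adj_compose[OF A] c(1) adj_compose_le[OF A c(2)]]]) simp
qed

text \<open>\<open>A\<close> intertwines \<open>adj A \<circ> A\<close> with
  \<open>A \<circ> adj A\<close>, and this passes to square roots built with the common constant
  \<open>c\<close>.\<close>

lemma abs_op_intertwine:
  assumes A: "bounded_clinear A"
  shows "A (abs_op A x) = abs_op (adj A) (A x)"
proof -
  note A' = bounded_clinear_adj[OF A]
  obtain a where a: "0 < a" "\<And>x. (norm (A x))\<^sup>2 \<le> a * (norm x)\<^sup>2" by (rule norm_squared_bound[OF A]) blast
  obtain b where b: "0 < b" "\<And>x. (norm (adj A x))\<^sup>2 \<le> b * (norm x)\<^sup>2" by (rule norm_squared_bound[OF A']) blast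
  define c where "c = a + b"
  have c: "0 < c" using a b by (simp add: c_def)
  have ca: "(norm (A x))\<^sup>2 \<le> c * (norm x)\<^sup>2" and cb: "(norm (adj A x))\<^sup>2 \<le> c * (norm x)\<^sup>2" for x
    using a(2)[of x] b(2)[of x] a(1) b(1) by (simp_all add: c_def distrib_right add_increasing add_increasing2)
  show ?thesis
    unfolding abs_op_eq_op_sqrt[OF A c ca] abs_op_eq_op_sqrt[OF A' c cb]
    by (rule op_sqrt_intertwine[where A = A, OF c psd_op_adj_compose[OF A] adj_compose_le[OF A ca]
          psd_op_adj_compose[OF A'] adj_compose_le[OF A' cb] bounded_clinearD(1)[OF A]])
      (simp add: adj_adj[OF A])
qed

text \<open>The real inequality is applied at \<open>y\<close> rotated by a phase, which leaves the
  form of \<open>abs_op (adj A)\<close> unchanged.\<close>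

theorem mixed_Schwarz:
  assumes A: "bounded_clinear A"
  shows "(cmod (cinner (A x) y))\<^sup>2 \<le> (abs_op A x \<bullet> x) * (abs_op (adj A) y \<bullet> y)"
proof -
  let ?P = "abs_op A" and ?Q = "abs_op (adj A)"
  have P: "psd_op ?P" by (intro psd_op_positive_op positive_op_abs_op A)
  have Q': "positive_op ?Q" by (intro positive_op_abs_op bounded_clinear_adj A)
  obtain c where c: "cmod c = 1" "A x \<bullet> (c *\<^sub>C y) = cmod (cinner (A x) y)" by (rule cinner_phase)
  have "A u \<bullet> A v = ?P u \<bullet> ?P v" for u v
    by (simp add: psd_opD(2)[OF P] abs_op_abs_op[OF A] inner_adj[OF A])
  then have "(A x \<bullet> (c *\<^sub>C y))\<^sup>2 \<le> (?P x \<bullet> x) * (?Q (c *\<^sub>C y) \<bullet> (c *\<^sub>C y))"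
    by (intro mixed_Schwarz_real bounded_clinearD(1) A P psd_op_positive_op Q' abs_op_intertwine)
  moreover have "?Q (c *\<^sub>C y) \<bullet> (c *\<^sub>C y) = ?Q y \<bullet> y"
  proof -
    have "?Q (c *\<^sub>C y) = c *\<^sub>C ?Q y" using Q' bounded_clinearD(2) by (auto simp: positive_op_def)
    then have "cinner (?Q (c *\<^sub>C y)) (c *\<^sub>C y) = c * cnj c * cinner (?Q y) y"
      by (simp add: cinner_scaleC_left cinner_scaleC_right)
    also have "c * cnj c = 1" using c(1) by (simp flip: complex_norm_square)
    finally show ?thesis by (simp add: inner_eq_Re_cinner)
  qed
  ultimately show ?thesis by (simp add: c(2))
qed

section \<open>The numerical radius\<close>

lemma
  assumes A: "bounded_clinear A"
  shows numerical_radius_nonneg: "0 \<le> numerical_radius A"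
    and cmod_cinner_le_numerical_radius: "norm x = 1 \<Longrightarrow> cmod (cinner (A x) x) \<le> numerical_radius A"
proof -
  let ?S = "insert 0 {cmod (cinner (A x) x) |x. norm x = 1}"
  obtain K where K: "\<And>x. norm (A x) \<le> norm x * K"
    using bounded_linear.bounded[OF bounded_clinearD(1)[OF A]] by blast
  have "cmod (cinner (A x) x) \<le> \<bar>K\<bar>" if "norm x = 1" for x
    using cmod_cinner_le[of "A x" x] K[of x] that by simp
  then have bdd: "bdd_above ?S" by (intro bdd_aboveI[of _ "\<bar>K\<bar>"]) auto
  show "0 \<le> numerical_radius A" unfolding numerical_radius_def by (rule cSup_upper[OF _ bdd]) simp
  show "cmod (cinner (A x) x) \<le> numerical_radius A" if "norm x = 1"
    unfolding numerical_radius_def using that by (intro cSup_upper[OF _ bdd]) auto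
qed

lemma cmod_cinner_le_numerical_radius_norm:
  assumes A: "bounded_clinear A"
  shows "cmod (cinner (A x) x) \<le> numerical_radius A * (norm x)\<^sup>2"
proof (cases "x = 0")
  case True
  then show ?thesis using cmod_cinner_le[of "A x" x] by simp
next
  case False
  define u where "u = (1 / norm x) *\<^sub>R x"
  have u: "norm u = 1" "x = complex_of_real (norm x) *\<^sub>C u"
    using False by (simp_all add: u_def flip: scaleR_scaleC)
  have "cinner (A x) x = (norm x)\<^sup>2 * cinner (A u) u"
    by (subst (1 2) u(2))
      (simp add: bounded_clinearD(2)[OF A] cinner_scaleC_left cinner_scaleC_right power2_eq_square)
  then have "cmod (cinner (A x) x) = (norm x)\<^sup>2 * cmod (cinner (A u) u)"
    by (simp add: norm_mult norm_power)
  also have "\<dots> \<le> (norm x)\<^sup>2 * numerical_radius A"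
    by (intro mult_left_mono cmod_cinner_le_numerical_radius A u) simp
  finally show ?thesis by (simp add: mult.commute)
qed

lemma numerical_radius_le:
  assumes "0 \<le> k" "\<And>x. norm x = 1 \<Longrightarrow> cmod (cinner (A x) x) \<le> k"
  shows "numerical_radius A \<le> k"
  unfolding numerical_radius_def using assms by (intro cSup_least) auto

section \<open>Real and imaginary parts of an operator\<close>

lemma bounded_clinear_Re_op: "bounded_clinear A \<Longrightarrow> bounded_clinear (Re_op A)"
  unfolding Re_op_def by (intro bounded_clinear_scaleC bounded_clinear_add bounded_clinear_adj)

text \<open>\<open>Re_op A\<close> is symmetric and has the same real form
  \<open>A x \<bullet> x\<close> as \<open>A\<close>.\<close>

lemma norm_Re_op_le:
  assumes A: "bounded_clinear A" and k: "\<And>x. \<bar>A x \<bullet> x\<bar> \<le> k * (norm x)\<^sup>2"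
  shows "norm (Re_op A x) \<le> k * norm x"
proof (rule symmetric_norm_le)
  have Re: "Re_op A x = (1/2) *\<^sub>R (A x + adj A x)" for x by (simp add: Re_op_def scaleR_scaleC)
  show "linear (Re_op A)"
    by (intro bounded_linear.linear bounded_clinearD(1) bounded_clinear_Re_op A)
  show "Re_op A x \<bullet> y = x \<bullet> Re_op A y" for x y
    by (simp add: Re inner_add_left inner_add_right inner_adj[OF A])
  have "Re_op A x \<bullet> x = A x \<bullet> x" for x
    by (simp add: Re inner_add_left inner_adj(2)[OF A] inner_commute[of x "A x"])
  then show "\<bar>Re_op A x \<bullet> x\<bar> \<le> k * (norm x)\<^sup>2" for x using k by simp
qed

text \<open>Reduces norm bounds for imaginary parts to those for real parts.\<close>

lemma Im_op_eq_Re_op: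
  assumes A: "bounded_clinear A"
  shows "Im_op A = Re_op (\<lambda>x. (- \<i>) *\<^sub>C A x)"
proof
  fix x
  have "\<i> *\<^sub>C adj A x = - ((- \<i>) *\<^sub>C adj A x)"
    using scaleC_scaleC[of "- 1" "- \<i>" "adj A x"] by (simp add: scaleC_minus_one)
  then have "(- \<i>) *\<^sub>C A x + \<i> *\<^sub>C adj A x = (- \<i>) *\<^sub>C (A x - adj A x)"
    by (simp add: scaleC_diff_right)
  then show "Im_op A x = Re_op (\<lambda>x. (- \<i>) *\<^sub>C A x) x"
    by (simp add: Im_op_def Re_op_def adj_scaleC[OF A] scaleC_scaleC)
qed

lemma norm_Re_op_Im_op_le:
  assumes A: "bounded_clinear A"
  shows "norm (Re_op A x) \<le> numerical_radius A * norm x"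
    and "norm (Im_op A x) \<le> numerical_radius A * norm x"
proof -
  note w = cmod_cinner_le_numerical_radius_norm[OF A]
  show "norm (Re_op A x) \<le> numerical_radius A * norm x"
    using order_trans[OF abs_Re_le_cmod w] by (intro norm_Re_op_le A) (simp add: inner_eq_Re_cinner)
  show "norm (Im_op A x) \<le> numerical_radius A * norm x"
    unfolding Im_op_eq_Re_op[OF A]
    using order_trans[OF abs_Im_le_cmod w]
    by (intro norm_Re_op_le bounded_clinear_scaleC A) (simp add: inner_eq_Re_cinner cinner_scaleC_left)
qed

text \<open>Real polarization of \<open>A x\<close> against \<open>adj A x\<close>.\<close>

lemma inner_square_eq:
  assumes A: "bounded_clinear A"
  shows "A (A x) \<bullet> x = (norm (Re_op A x))\<^sup>2 - (norm (Im_op A x))\<^sup>2"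
proof -
  have norms: "norm (Re_op A x) = norm (A x + adj A x) / 2" "norm (Im_op A x) = norm (A x - adj A x) / 2"
    by (simp_all add: Re_op_def Im_op_def norm_scaleC norm_divide norm_mult)
  have "(norm (Re_op A x))\<^sup>2 - (norm (Im_op A x))\<^sup>2 = A x \<bullet> adj A x"
    unfolding norms by (simp add: power_divide power2_norm_eq_inner inner_add_left inner_add_right inner_diff_left
        inner_diff_right inner_commute[of "adj A x" "A x"] field_simps)
  then show ?thesis by (simp add: inner_adj(1)[OF A])
qed

text \<open>The form of \<open>A \<circ> A\<close> is a difference of two numbers between 0 and
  \<open>(numerical_radius A)\<^sup>2 * (norm x)\<^sup>2\<close>, so its modulus obeys the same
  bound.\<close>

lemma onorm_Re_op_square_le:
  assumes A: "bounded_clinear A"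
  shows "onorm (Re_op (A \<circ> A)) \<le> (numerical_radius A)\<^sup>2"
proof (intro onorm_bound norm_Re_op_le bounded_clinear_compose A zero_le_power2)
  fix x
  have "(norm (Re_op A x))\<^sup>2 \<le> (numerical_radius A)\<^sup>2 * (norm x)\<^sup>2"
    "(norm (Im_op A x))\<^sup>2 \<le> (numerical_radius A)\<^sup>2 * (norm x)\<^sup>2"
    using norm_Re_op_Im_op_le[OF A, of x] by (metis norm_ge_zero power_mono power_mult_distrib)+
  moreover have "0 \<le> (norm (Re_op A x))\<^sup>2" "0 \<le> (norm (Im_op A x))\<^sup>2" by simp_all
  ultimately show "\<bar>(A \<circ> A) x \<bullet> x\<bar> \<le> (numerical_radius A)\<^sup>2 * (norm x)\<^sup>2"
    unfolding o_def inner_square_eq[OF A] by linarith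
qed

lemma numerical_radius_squared_le:
  assumes A: "bounded_clinear A"
  shows "(numerical_radius A)\<^sup>2
         \<le> 1 / 2 * numerical_radius (\<lambda>x. abs_op A x + \<i> *\<^sub>C abs_op (adj A) x)
                 * numerical_radius (\<lambda>x. abs_op (adj A) x + \<i> *\<^sub>C abs_op A x)"
    (is "_ \<le> 1 / 2 * numerical_radius ?F * numerical_radius ?G")
proof -
  let ?P = "abs_op A" and ?Q = "abs_op (adj A)"
  have P: "positive_op ?P" and Q: "positive_op ?Q"
    by (intro positive_op_abs_op bounded_clinear_adj A)+
  then have bc: "bounded_clinear ?P" "bounded_clinear ?Q" by (simp_all add: positive_op_def)
  have F: "bounded_clinear ?F" and G: "bounded_clinear ?G"
    by (intro bounded_clinear_add bounded_clinear_scaleC bc)+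
  have "numerical_radius A \<le> sqrt (1 / 2 * numerical_radius ?F * numerical_radius ?G)"
  proof (rule numerical_radius_le)
    show "0 \<le> sqrt (1 / 2 * numerical_radius ?F * numerical_radius ?G)"
      using numerical_radius_nonneg[OF F] numerical_radius_nonneg[OF G] by simp
    fix x :: 'a assume x: "norm x = 1"
    define p q where "p = ?P x \<bullet> x" and "q = ?Q x \<bullet> x"
    \<comment> \<open>By positivity the complex forms are the reals \<open>p\<close> and
      \<open>q\<close>, so \<open>?F\<close> and \<open>?G\<close> have the forms
      \<open>p + \<i> * q\<close> and \<open>q + \<i> * p\<close>.\<close>
    have "cinner (?P x) x = p" "cinner (?Q x) x = q"
      using P Q by (auto simp: positive_op_def complex_is_Real_iff p_def q_def inner_eq_Re_cinner complex_eq_iff)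
    then have mod: "cmod (cinner (?F x) x) = sqrt (p\<^sup>2 + q\<^sup>2)" "cmod (cinner (?G x) x) = sqrt (p\<^sup>2 + q\<^sup>2)"
      by (simp_all add: cinner_add_left cinner_scaleC_left cmod_def add.commute)
    have "(cmod (cinner (A x) x))\<^sup>2 \<le> p * q" unfolding p_def q_def by (rule mixed_Schwarz[OF A])
    also have "\<dots> \<le> 1 / 2 * (p\<^sup>2 + q\<^sup>2)"
      using zero_le_power2[of "p - q"] by (simp add: power2_diff)
    also have "p\<^sup>2 + q\<^sup>2 = cmod (cinner (?F x) x) * cmod (cinner (?G x) x)" by (simp add: mod)
    also have "\<dots> \<le> numerical_radius ?F * numerical_radius ?G"
      by (intro mult_mono cmod_cinner_le_numerical_radius F G x numerical_radius_nonneg) simp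
    finally show "cmod (cinner (A x) x) \<le> sqrt (1 / 2 * numerical_radius ?F * numerical_radius ?G)"
      by (intro real_le_rsqrt) simp
  qed
  then have "(numerical_radius A)\<^sup>2 \<le> (sqrt (1 / 2 * numerical_radius ?F * numerical_radius ?G))\<^sup>2"
    using numerical_radius_nonneg[OF A] by (intro power_mono)
  also have "\<dots> = 1 / 2 * numerical_radius ?F * numerical_radius ?G"
    using numerical_radius_nonneg[OF F] numerical_radius_nonneg[OF G] by simp
  finally show ?thesis .
qed

theorem corollary2p7:
  fixes A :: "'a::complex_hilbert \<Rightarrow> 'a"
  assumes "bounded_clinear A"
  shows "1 / 2 * onorm (Re_op (A \<circ> A))
           + 1 / 2 * numerical_radius A * \<bar>onorm (Re_op A) - onorm (Im_op A)\<bar>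
         \<le> (numerical_radius A)\<^sup>2
       \<and> (numerical_radius A)\<^sup>2
         \<le> 1 / 2 * numerical_radius (\<lambda>x. abs_op A x + \<i> *\<^sub>C abs_op (adj A) x)
                 * numerical_radius (\<lambda>x. abs_op (adj A) x + \<i> *\<^sub>C abs_op A x)"
proof
  note w0 = numerical_radius_nonneg[OF assms]
  have "bounded_clinear (Im_op A)"
    unfolding Im_op_eq_Re_op[OF assms] by (intro bounded_clinear_Re_op bounded_clinear_scaleC assms)
  then have "0 \<le> onorm (Re_op A)" "0 \<le> onorm (Im_op A)"
    by (simp_all add: onorm_pos_le bounded_clinearD(1) bounded_clinear_Re_op assms)
  moreover have "onorm (Re_op A) \<le> numerical_radius A" "onorm (Im_op A) \<le> numerical_radius A"
    by (intro onorm_bound norm_Re_op_Im_op_le assms w0)+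
  ultimately have "\<bar>onorm (Re_op A) - onorm (Im_op A)\<bar> \<le> numerical_radius A" by linarith
  then have "numerical_radius A * \<bar>onorm (Re_op A) - onorm (Im_op A)\<bar> \<le> (numerical_radius A)\<^sup>2"
    using w0 by (simp add: power2_eq_square mult_left_mono)
  then show "1 / 2 * onorm (Re_op (A \<circ> A))
      + 1 / 2 * numerical_radius A * \<bar>onorm (Re_op A) - onorm (Im_op A)\<bar> \<le> (numerical_radius A)\<^sup>2"
    using onorm_Re_op_square_le[OF assms] by simp
qed (rule numerical_radius_squared_le[OF assms])

end
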